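(* Let $C_5$ be the cyclic group of order $5$ and let $\lambda(C_5)$ be its superextension. Then $\mathrm{Aut}(\lambda(C_5))\cong\mathrm{Aut}(C_5)\cong C_4$, where $\mathrm{Aut}(\lambda(C_5))$ is the group of semigroup automorphisms of $\lambda(C_5)$.
   Context: $C_n$ denotes the cyclic group of order $n$. A family $\mathcal A$ of non-empty subsets of a set $X$ is an upfamily if $A\in\mathcal A$ and $A\subset B\subset X$ imply $B\in\mathcal A$. A family $\mathcal B$ of non-empty subsets of $X$ generates the upfamily $\langle \mathcal B\rangle=\{A\subset X:\exists B\in\mathcal B\ (B\subset A)\}$; we write $\langle B: B\in\mathcal B\rangle$ for it. An upfamily $\mathcal L$ is linked if $A\cap B\neq\emptyset$ for all $A,B\in\mathcal L$. The superextension $\lambda(X)$ is the set of all maximal (with respect to inclusion) linked upfamilies on $X$. For a semigroup $S$ (in particular, a group) with operation $*$, the set $\lambda(S)$ is a semigroup under the (known to be well-defined and associative) operation $$\mathcal A*\mathcal B=\Big\langle\bigcup_{a\in A}a*B_a : A\in\mathcal A,\ \{B_a\}_{a\in A}\subset\mathcal B\Big\rangle .$$ *)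

theory Defs
  imports "HOL-Algebra.Elementary_Groups" "HOL-Algebra.Bij"
begin

definition upfamily :: "'a set \<Rightarrow> 'a set set \<Rightarrow> bool" where
  "upfamily X \<A> \<longleftrightarrow>
     (\<forall>A\<in>\<A>. A \<subseteq> X \<and> A \<noteq> {}) \<and>
     (\<forall>A B. A \<in> \<A> \<and> A \<subseteq> B \<and> B \<subseteq> X \<longrightarrow> B \<in> \<A>)"

definition generated_upfamily :: "'a set \<Rightarrow> 'a set set \<Rightarrow> 'a set set" where
  "generated_upfamily X \<B> = {A. A \<subseteq> X \<and> (\<exists>B\<in>\<B>. B \<subseteq> A)}"

definition linked :: "'a set set \<Rightarrow> bool" where
  "linked \<L> \<longleftrightarrow> (\<forall>A\<in>\<L>. \<forall>B\<in>\<L>. A \<inter> B \<noteq> {})"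

definition superextension :: "'a set \<Rightarrow> 'a set set set" where
  "superextension X =
     {\<L>. upfamily X \<L> \<and> linked \<L> \<and>
          (\<forall>\<M>. upfamily X \<M> \<and> linked \<M> \<and> \<L> \<subseteq> \<M> \<longrightarrow> \<M> = \<L>)}"

text \<open>
  A family of sets \<open>B\<^sub>a\<close> with \<open>a\<close> in \<open>A\<close> is a function on the whole type whose values are
  constrained only on \<open>A\<close>; the library's left coset \<open>a <#\<^bsub>S\<^esub> B a\<close> is the translate
  \<open>a * B\<^sub>a\<close>.
\<close>

definition superext_mult ::
    "('a, 'b) monoid_scheme \<Rightarrow> 'a set set \<Rightarrow> 'a set set \<Rightarrow> 'a set set" where
  "superext_mult S \<A> \<B> =
     generated_upfamily (carrier S)
       {(\<Union>a\<in>A. a <#\<^bsub>S\<^esub> B a) | A B. A \<in> \<A> \<and> (\<forall>a\<in>A. B a \<in> \<B>)}"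

text \<open>
  The superextension as a semigroup. The record type demands a unit; we put the principal
  ultrafilter at the unit of \<open>S\<close>, but \<open>hom\<close>, \<open>auto\<close> and the multiplication of \<open>AutoGroup\<close> never
  refer to that field, so \<open>AutoGroup\<close> of this structure consists of exactly the
  semigroup automorphisms.
\<close>

definition superext_semigroup :: "('a, 'b) monoid_scheme \<Rightarrow> 'a set set monoid" where
  "superext_semigroup S =
     \<lparr>carrier = superextension (carrier S),
      monoid.mult = superext_mult S,
      one = generated_upfamily (carrier S) {{\<one>\<^bsub>S\<^esub>}}\<rparr>"

end

theory Submission
  imports Defs "HOL-Algebra.Multiplicative_Group" "HOL-Library.Numeral_Type"
begin

text \<open>
  A nonprincipal maximal linked upfamily on \<open>C\<^sub>5\<close> is determined by the two-element sets it
  contains, that is, by a family of pairwise intersecting edges \<open>{x, x + 1}\<close> and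
  \<open>{x, x + 2}\<close>. Right multiplication by the nonprincipal idempotent consisting of the two edges
  \<open>{0, \<plusminus>d}\<close> discards the edges of the other type, so an automorphism that fixes the principal
  ultrafilters permutes these two idempotents and acts by a translation on the families with a single
  edge of a given type. The edges of type 2 that meet both edges \<open>{0, \<plusminus>1}\<close> are \<open>{y, y + 2}\<close> with
  \<open>y \<in> {0, 3, 4}\<close>, and those of type 1 that meet both \<open>{0, \<plusminus>2}\<close> are \<open>{y, y + 1}\<close> with
  \<open>y \<in> {0, 2, 4}\<close>. Neither set has a nontrivial translation symmetry and they are not translates of
  each other, so the automorphism is the identity. Since every automorphism permutes the principal
  ultrafilters through an automorphism of \<open>C\<^sub>5\<close>, all automorphisms are induced from \<open>C\<^sub>5\<close>.
\<close>

section \<open>Superextensions as self-dual families\<close>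

text \<open>Self-duality forces both properties: if \<open>A\<close> and \<open>B\<close> were
  disjoint members, \<open>X - A\<close> would contain \<open>B\<close> and so be a member together
  with \<open>A\<close>; and a larger linked family with a new member \<open>A\<close> would also
  contain \<open>X - A\<close>, which already lies in \<open>L\<close>.\<close>

lemma superextensionI:
  assumes sub: "\<And>A. A \<in> L \<Longrightarrow> A \<subseteq> X"
    and up: "\<And>A B. A \<in> L \<Longrightarrow> A \<subseteq> B \<Longrightarrow> B \<subseteq> X \<Longrightarrow> B \<in> L"
    and dual: "\<And>A. A \<subseteq> X \<Longrightarrow> X - A \<in> L \<longleftrightarrow> A \<notin> L"
  shows "L \<in> superextension X"
proof -
  have ne: "{} \<notin> L"
    using up[of "{}" X] dual[of "{}"] by auto
  have linked: "linked L"
    unfolding linked_def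
  proof (intro ballI notI)
    fix A B assume AB: "A \<in> L" "B \<in> L" "A \<inter> B = {}"
    then have "X - A \<in> L"
      using up[of B "X - A"] sub[of B] by auto
    then show False
      using dual[of A] sub[of A] AB by auto
  qed
  have "M = L" if M: "upfamily X M" "linked M" "L \<subseteq> M" for M
  proof -
    have "A \<in> L" if "A \<in> M" for A
    proof (rule ccontr)
      assume "A \<notin> L"
      moreover have "A \<subseteq> X"
        using conjunct1[OF M(1)[unfolded upfamily_def]] that by blast
      ultimately have "X - A \<in> M"
        using dual[of A] M(3) by auto
      then have "A \<inter> (X - A) \<noteq> {}"
        using M(2) that unfolding linked_def by blast
      then show False
        by blast
    qed
    then show ?thesis
      using M(3) by blast
  qed
  moreover have "upfamily X L"
    using sub up ne unfolding upfamily_def by blast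
  ultimately show ?thesis
    using linked by (simp add: superextension_def)
qed

lemma superextension_subset: "L \<in> superextension X \<Longrightarrow> A \<in> L \<Longrightarrow> A \<subseteq> X"
  unfolding superextension_def upfamily_def by blast

lemma superextension_upward:
  "L \<in> superextension X \<Longrightarrow> A \<in> L \<Longrightarrow> A \<subseteq> B \<Longrightarrow> B \<subseteq> X \<Longrightarrow> B \<in> L"
  unfolding superextension_def upfamily_def by blast

lemma superextension_meet: "L \<in> superextension X \<Longrightarrow> A \<in> L \<Longrightarrow> B \<in> L \<Longrightarrow> A \<inter> B \<noteq> {}"
  unfolding superextension_def linked_def by blast

lemma superextension_nonempty: "L \<in> superextension X \<Longrightarrow> {} \<notin> L"
  unfolding superextension_def upfamily_def by blast

text \<open>Converse of \<open>superextensionI\<close>. By maximality, adding the supersets of a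
  nonmember \<open>A\<close> destroys linkedness, so some member misses \<open>A\<close> and
  \<open>X - A\<close> contains it. Over the empty set the empty family is maximal linked and not
  self-dual, which explains the hypothesis on \<open>X\<close>.\<close>

lemma superextension_dual:
  assumes L: "L \<in> superextension X" and "X \<noteq> {}" "A \<subseteq> X"
  shows "X - A \<in> L \<longleftrightarrow> A \<notin> L"
proof
  show "A \<notin> L" if "X - A \<in> L"
    using superextension_meet[OF L that, of A] by blast
next
  have max: "M = L" if "upfamily X M" "linked M" "L \<subseteq> M" for M
    using L that by (simp add: superextension_def)
  assume A: "A \<notin> L"
  show "X - A \<in> L"
  proof (cases "A = {}")
    case True
    \<comment> \<open>The supersets of the empty set do not form an upfamily, so this case adds only
      the whole set \<open>X\<close>.\<close>
    have sub: "B \<subseteq> X" "B \<noteq> {}" if "B \<in> L" for B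
      using superextension_subset[OF L that] superextension_nonempty[OF L] that by auto
    have "linked (insert X L)"
      using sub \<open>X \<noteq> {}\<close> superextension_meet[OF L] unfolding linked_def by blast
    moreover have "upfamily X (insert X L)"
      using sub \<open>X \<noteq> {}\<close> superextension_upward[OF L] unfolding upfamily_def by blast
    ultimately have "insert X L = L"
      by (intro max) auto
    then show ?thesis
      using True by auto
  next
    case False
    define M where "M = L \<union> {B. A \<subseteq> B \<and> B \<subseteq> X}"
    have "M \<noteq> L"
      using A \<open>A \<subseteq> X\<close> by (auto simp: M_def)
    moreover have "upfamily X M"
      unfolding upfamily_def
    proof (intro conjI ballI allI impI)
      fix B C assume "B \<in> M \<and> B \<subseteq> C \<and> C \<subseteq> X"
      then show "C \<in> M"
        using superextension_upward[OF L, of B C] by (auto simp: M_def)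
    next
      fix B assume "B \<in> M"
      then show "B \<subseteq> X" "B \<noteq> {}"
        using superextension_subset[OF L, of B] superextension_nonempty[OF L] False
        by (auto simp: M_def)
    qed
    ultimately have "\<not> linked M"
      using max[of M] by (auto simp: M_def)
    then obtain C D where CD: "C \<in> M" "D \<in> M" "C \<inter> D = {}"
      by (auto simp: linked_def)
    have "\<exists>B\<in>L. B \<inter> A = {}"
      using CD superextension_meet[OF L, of C D] False unfolding M_def by blast
    then obtain B where "B \<in> L" "B \<inter> A = {}" ..
    then show ?thesis
      using superextension_upward[OF L, of B "X - A"] superextension_subset[OF L, of B] by auto
  qed
qed

text \<open>For fixed \<open>X\<close> and \<open>a\<close>, the largest set whose translate by
  \<open>a\<close> lies in \<open>X\<close> is the preimage of \<open>X\<close> under left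
  multiplication by \<open>a\<close>. Upward closure of \<open>M\<close> allows every
  \<open>B a\<close> to be replaced by this preimage, and upward closure of \<open>L\<close> allows
  \<open>A\<close> to be replaced by the set of all \<open>a\<close> whose preimage lies in
  \<open>M\<close>.\<close>

lemma (in group) superext_mult_eq:
  assumes L: "L \<in> superextension (carrier G)" and M: "M \<in> superextension (carrier G)"
  shows "superext_mult G L M =
    {X. X \<subseteq> carrier G \<and> {a \<in> carrier G. {x \<in> carrier G. a \<otimes> x \<in> X} \<in> M} \<in> L}"
proof (intro Set.set_eqI iffI)
  fix X assume "X \<in> superext_mult G L M"
  then obtain A B where X: "X \<subseteq> carrier G" and A: "A \<in> L"
    and B: "\<forall>a\<in>A. B a \<in> M" "(\<Union>a\<in>A. a <# B a) \<subseteq> X"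
    by (auto simp: superext_mult_def generated_upfamily_def)
  have AG: "A \<subseteq> carrier G"
    using superextension_subset[OF L A] .
  have "A \<subseteq> {a \<in> carrier G. {x \<in> carrier G. a \<otimes> x \<in> X} \<in> M}"
  proof
    fix a assume a: "a \<in> A"
    then have "B a \<in> M" "B a \<subseteq> carrier G"
      using B superextension_subset[OF M] by auto
    moreover have "B a \<subseteq> {x \<in> carrier G. a \<otimes> x \<in> X}"
      using B(2) a \<open>B a \<subseteq> carrier G\<close> by (auto simp: l_coset_def)
    ultimately have "{x \<in> carrier G. a \<otimes> x \<in> X} \<in> M"
      using superextension_upward[OF M] by blast
    then show "a \<in> {a \<in> carrier G. {x \<in> carrier G. a \<otimes> x \<in> X} \<in> M}"
      using a AG by blast
  qed
  then show "X \<in> {X. X \<subseteq> carrier G \<and> {a \<in> carrier G. {x \<in> carrier G. a \<otimes> x \<in> X} \<in> M} \<in> L}"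
    using X superextension_upward[OF L A] by blast
next
  fix X assume "X \<in> {X. X \<subseteq> carrier G \<and> {a \<in> carrier G. {x \<in> carrier G. a \<otimes> x \<in> X} \<in> M} \<in> L}"
  then have X: "X \<subseteq> carrier G" and A: "{a \<in> carrier G. {x \<in> carrier G. a \<otimes> x \<in> X} \<in> M} \<in> L"
    by auto
  let ?B = "\<lambda>a. {x \<in> carrier G. a \<otimes> x \<in> X}"
  let ?A = "{a \<in> carrier G. ?B a \<in> M}"
  have "(\<Union>a\<in>?A. a <# ?B a) \<in> {(\<Union>a\<in>A. a <# B a) | A B. A \<in> L \<and> (\<forall>a\<in>A. B a \<in> M)}"
    by (rule CollectI, rule exI[of _ ?A], rule exI[of _ ?B]) (use A in simp)
  moreover have "(\<Union>a\<in>?A. a <# ?B a) \<subseteq> X"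
    by (auto simp: l_coset_def)
  ultimately show "X \<in> superext_mult G L M"
    using X unfolding superext_mult_def generated_upfamily_def by (intro CollectI conjI) (assumption, rule bexI)
qed

text \<open>In the formula of \<open>superext_mult_eq\<close> complements pass first through
  \<open>M\<close> and then through \<open>L\<close>, so self-duality is inherited.\<close>

lemma (in group) superext_mult_closed:
  assumes L: "L \<in> superextension (carrier G)" and M: "M \<in> superextension (carrier G)"
  shows "superext_mult G L M \<in> superextension (carrier G)"
proof (rule superextensionI)
  have ne: "carrier G \<noteq> {}"
    by auto
  show "A \<subseteq> carrier G" if "A \<in> superext_mult G L M" for A
    using that by (simp add: superext_mult_eq[OF L M])
  show "B \<in> superext_mult G L M"
    if A: "A \<in> superext_mult G L M" and AB: "A \<subseteq> B" "B \<subseteq> carrier G" for A B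
  proof -
    have "{x \<in> carrier G. a \<otimes> x \<in> B} \<in> M" if "{x \<in> carrier G. a \<otimes> x \<in> A} \<in> M" for a
      by (rule superextension_upward[OF M that]) (use AB in auto)
    then have "{a \<in> carrier G. {x \<in> carrier G. a \<otimes> x \<in> A} \<in> M}
        \<subseteq> {a \<in> carrier G. {x \<in> carrier G. a \<otimes> x \<in> B} \<in> M}"
      by auto
    then show ?thesis
      using A AB superextension_upward[OF L] by (auto simp: superext_mult_eq[OF L M])
  qed
  show "carrier G - A \<in> superext_mult G L M \<longleftrightarrow> A \<notin> superext_mult G L M"
    if A: "A \<subseteq> carrier G" for A
  proof -
    have "{x \<in> carrier G. a \<otimes> x \<in> carrier G - A} = carrier G - {x \<in> carrier G. a \<otimes> x \<in> A}"
      if "a \<in> carrier G" for a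
      using that by auto
    then have "{a \<in> carrier G. {x \<in> carrier G. a \<otimes> x \<in> carrier G - A} \<in> M}
        = {a \<in> carrier G. carrier G - {x \<in> carrier G. a \<otimes> x \<in> A} \<in> M}"
      by auto
    also have "\<dots> = carrier G - {a \<in> carrier G. {x \<in> carrier G. a \<otimes> x \<in> A} \<in> M}"
      using superextension_dual[OF M ne] by auto
    finally show ?thesis
      using A superextension_dual[OF L ne] by (auto simp: superext_mult_eq[OF L M])
  qed
qed

section \<open>Functoriality\<close>

text \<open>Preimages commute with the set comprehensions in \<open>superext_mult_eq\<close>, so
  this form of the pushforward is the convenient one for transporting products.\<close>

lemma image_image_mem_iff:
  assumes h: "bij_betw h X Y" and L: "L \<subseteq> Pow X" and B: "B \<subseteq> Y"
  shows "B \<in> image h ` L \<longleftrightarrow> {x \<in> X. h x \<in> B} \<in> L"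
proof
  assume "B \<in> image h ` L"
  then obtain A where A: "A \<in> L" "B = h ` A"
    by auto
  then have "{x \<in> X. h x \<in> B} = A"
    using h L unfolding bij_betw_def inj_on_def by blast
  then show "{x \<in> X. h x \<in> B} \<in> L"
    using A by simp
next
  assume "{x \<in> X. h x \<in> B} \<in> L"
  moreover have "B = h ` {x \<in> X. h x \<in> B}"
    using h B unfolding bij_betw_def by blast
  ultimately show "B \<in> image h ` L"
    by blast
qed

lemma superextension_image:
  assumes h: "bij_betw h X Y" and L: "L \<in> superextension X" and ne: "X \<noteq> {}"
  shows "image h ` L \<in> superextension Y"
proof -
  have LX: "L \<subseteq> Pow X"
    using superextension_subset[OF L] by auto
  note mem = image_image_mem_iff[OF h LX]
  have sub: "A \<subseteq> Y" if "A \<in> image h ` L" for A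
    using that LX h by (auto simp: bij_betw_def)
  show ?thesis
  proof (rule superextensionI)
    show "A \<subseteq> Y" if "A \<in> image h ` L" for A
      using that by (rule sub)
    show "B \<in> image h ` L" if "A \<in> image h ` L" "A \<subseteq> B" "B \<subseteq> Y" for A B
    proof -
      have "{x \<in> X. h x \<in> A} \<in> L"
        using that(1) mem[OF sub] by simp
      then have "{x \<in> X. h x \<in> B} \<in> L"
        by (rule superextension_upward[OF L]) (use that in auto)
      then show ?thesis
        using mem[OF that(3)] by simp
    qed
    show "Y - A \<in> image h ` L \<longleftrightarrow> A \<notin> image h ` L" if A: "A \<subseteq> Y" for A
    proof -
      have "{x \<in> X. h x \<in> Y - A} = X - {x \<in> X. h x \<in> A}"
        using h by (auto simp: bij_betw_def)
      then have "Y - A \<in> image h ` L \<longleftrightarrow> X - {x \<in> X. h x \<in> A} \<in> L"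
        by (simp add: mem)
      then show ?thesis
        using mem[OF A] superextension_dual[OF L ne, of "{x \<in> X. h x \<in> A}"] by auto
    qed
  qed
qed

lemma bij_betw_superextension_image:
  assumes h: "bij_betw h X Y" and ne: "X \<noteq> {}"
  shows "bij_betw (\<lambda>L. image h ` L) (superextension X) (superextension Y)"
proof -
  have inv: "bij_betw (inv_into X h) Y X"
    using h by (rule bij_betw_inv_into)
  have hY: "h ` X = Y"
    using h by (simp add: bij_betw_def)
  have "Y \<noteq> {}"
    using ne hY by auto
  have 1: "image (inv_into X h) ` (image h ` L) = L" if "L \<in> superextension X" for L
  proof -
    have "inv_into X h ` (h ` A) = A" if "A \<in> L" for A
      using superextension_subset[OF \<open>L \<in> superextension X\<close> that] h
      by (meson bij_betw_def inv_into_image_cancel)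
    then show ?thesis
      by (simp add: image_image)
  qed
  have 2: "image h ` (image (inv_into X h) ` L) = L" if "L \<in> superextension Y" for L
  proof -
    have "h ` (inv_into X h ` A) = A" if "A \<in> L" for A
      using superextension_subset[OF \<open>L \<in> superextension Y\<close> that] hY
      by (metis image_inv_into_cancel)
    then show ?thesis
      by (simp add: image_image)
  qed
  show ?thesis
    by (rule bij_betw_byWitness[where f' = "\<lambda>L. image (inv_into X h) ` L"])
      (use 1 2 superextension_image[OF h _ ne] superextension_image[OF inv _ \<open>Y \<noteq> {}\<close>] in auto)
qed

text \<open>Pulling both levels of the product formula for \<open>H\<close> back along
  \<open>h\<close> turns it into the formula for \<open>G\<close>; the homomorphism law enters only
  through fact \<open>1\<close>.\<close>

lemma superext_mult_image:
  assumes G: "group G" and H: "group H" and h: "h \<in> iso G H"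
    and L: "L \<in> superextension (carrier G)" and M: "M \<in> superextension (carrier G)"
  shows "image h ` superext_mult G L M = superext_mult H (image h ` L) (image h ` M)"
proof (rule Set.set_eqI)
  fix B
  interpret G: group G by (rule G)
  interpret H: group H by (rule H)
  have bij: "bij_betw h (carrier G) (carrier H)" and hom: "h \<in> hom G H"
    using h by (auto simp: iso_def)
  have ne: "carrier G \<noteq> {}"
    by auto
  have LM: "superext_mult G L M \<in> superextension (carrier G)"
    using L M by (rule G.superext_mult_closed)
  note im = superextension_image[OF bij _ ne]
  have mem: "C \<in> image h ` K \<longleftrightarrow> {x \<in> carrier G. h x \<in> C} \<in> K"
    if "K \<in> superextension (carrier G)" "C \<subseteq> carrier H" for K C
    using superextension_subset[OF that(1)] that(2) by (intro image_image_mem_iff[OF bij]) auto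
  show "B \<in> image h ` superext_mult G L M \<longleftrightarrow> B \<in> superext_mult H (image h ` L) (image h ` M)"
  proof (cases "B \<subseteq> carrier H")
    case False
    then show ?thesis
      using superextension_subset[OF im[OF LM]]
        superextension_subset[OF H.superext_mult_closed[OF im[OF L] im[OF M]]] by blast
  next
    case True
    have ha: "h a \<in> carrier H" if "a \<in> carrier G" for a
      using hom that by (rule hom_in_carrier)
    have 1: "{x \<in> carrier G. h x \<in> {y \<in> carrier H. h a \<otimes>\<^bsub>H\<^esub> y \<in> B}}
        = {x \<in> carrier G. a \<otimes>\<^bsub>G\<^esub> x \<in> {x \<in> carrier G. h x \<in> B}}" if "a \<in> carrier G" for a
      using that hom ha by (auto simp: hom_mult)
    have "B \<in> superext_mult H (image h ` L) (image h ` M) \<longleftrightarrow>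
        {b \<in> carrier H. {y \<in> carrier H. b \<otimes>\<^bsub>H\<^esub> y \<in> B} \<in> image h ` M} \<in> image h ` L"
      using True by (simp add: H.superext_mult_eq[OF im[OF L] im[OF M]])
    also have "\<dots> \<longleftrightarrow> {a \<in> carrier G. h a \<in> {b \<in> carrier H. {y \<in> carrier H. b \<otimes>\<^bsub>H\<^esub> y \<in> B} \<in> image h ` M}} \<in> L"
      by (rule mem[OF L]) auto
    also have "{a \<in> carrier G. h a \<in> {b \<in> carrier H. {y \<in> carrier H. b \<otimes>\<^bsub>H\<^esub> y \<in> B} \<in> image h ` M}}
        = {a \<in> carrier G. {y \<in> carrier H. h a \<otimes>\<^bsub>H\<^esub> y \<in> B} \<in> image h ` M}"
      using ha by auto
    also have "\<dots> = {a \<in> carrier G. {x \<in> carrier G. h x \<in> {y \<in> carrier H. h a \<otimes>\<^bsub>H\<^esub> y \<in> B}} \<in> M}"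
      by (intro Collect_cong conj_cong refl mem[OF M]) auto
    also have "\<dots> = {a \<in> carrier G. {x \<in> carrier G. a \<otimes>\<^bsub>G\<^esub> x \<in> {x \<in> carrier G. h x \<in> B}} \<in> M}"
      by (intro Collect_cong conj_cong refl) (simp only: 1)
    also have "\<dots> \<in> L \<longleftrightarrow> {x \<in> carrier G. h x \<in> B} \<in> superext_mult G L M"
      by (simp add: G.superext_mult_eq[OF L M])
    also have "\<dots> \<longleftrightarrow> B \<in> image h ` superext_mult G L M"
      using mem[OF LM True] by simp
    finally show ?thesis
      by simp
  qed
qed

lemma superext_semigroup_simps [simp]:
  "carrier (superext_semigroup S) = superextension (carrier S)"
  "monoid.mult (superext_semigroup S) = superext_mult S"
  by (simp_all add: superext_semigroup_def)

lemma superext_semigroup_iso: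
  assumes "group G" "group H" and h: "h \<in> iso G H"
  shows "(\<lambda>L. image h ` L) \<in> iso (superext_semigroup G) (superext_semigroup H)"
proof -
  have bij: "bij_betw h (carrier G) (carrier H)"
    using h by (simp add: iso_def)
  have "carrier G \<noteq> {}"
    using monoid.one_closed[OF group.is_monoid[OF \<open>group G\<close>]] by auto
  then have "bij_betw (\<lambda>L. image h ` L) (superextension (carrier G)) (superextension (carrier H))"
    by (rule bij_betw_superextension_image[OF bij])
  moreover from this have
    "(\<lambda>L. image h ` L) \<in> hom (superext_semigroup G) (superext_semigroup H)"
    by (intro homI) (simp_all add: superext_mult_image[OF assms] bij_betw_apply)
  ultimately show ?thesis
    by (simp add: iso_def)
qed

section \<open>Transport of automorphism groups along isomorphisms\<close>

lemma mult_AutoGroup: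
  "f \<in> auto G \<Longrightarrow> g \<in> auto G \<Longrightarrow> f \<otimes>\<^bsub>AutoGroup G\<^esub> g = compose (carrier G) f g"
  by (simp add: AutoGroup_def BijGroup_def auto_def)

lemma carrier_AutoGroup [simp]: "carrier (AutoGroup G) = auto G"
  by (simp add: AutoGroup_def)

lemma conj_auto:
  assumes h: "h \<in> iso G H"
    and closed: "\<And>x y. x \<in> carrier G \<Longrightarrow> y \<in> carrier G \<Longrightarrow> x \<otimes>\<^bsub>G\<^esub> y \<in> carrier G"
    and f: "f \<in> auto G"
  shows "(\<lambda>y\<in>carrier H. h (f (inv_into (carrier G) h y))) \<in> auto H"
proof -
  let ?k = "inv_into (carrier G) h"
  have bij: "bij_betw h (carrier G) (carrier H)" and hom: "h \<in> hom G H"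
    using h by (auto simp: iso_def)
  have fb: "bij_betw f (carrier G) (carrier G)" and fh: "f \<in> hom G G"
    using f by (auto simp: auto_def Bij_def)
  have k: "bij_betw ?k (carrier H) (carrier G)"
    using bij by (rule bij_betw_inv_into)
  have "bij_betw (h \<circ> (f \<circ> ?k)) (carrier H) (carrier H)"
    using k fb bij by (intro bij_betw_trans)
  then have "bij_betw (\<lambda>y\<in>carrier H. h (f (?k y))) (carrier H) (carrier H)"
    by (subst bij_betw_cong[where g = "h \<circ> (f \<circ> ?k)"]) simp_all
  moreover have "(\<lambda>y\<in>carrier H. h (f (?k y))) \<in> hom H H"
  proof (rule homI)
    fix u v assume uv: "u \<in> carrier H" "v \<in> carrier H"
    define x where "x = ?k u"
    define y where "y = ?k v"
    have xy: "x \<in> carrier G" "y \<in> carrier G" "h x = u" "h y = v"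
      using uv by (simp_all add: x_def y_def bij_betw_apply[OF k] bij_betw_inv_into_right[OF bij])
    show "(\<lambda>y\<in>carrier H. h (f (?k y))) u \<in> carrier H"
      using uv xy(1) by (simp add: x_def[symmetric] bij_betw_apply[OF fb] bij_betw_apply[OF bij])
    have "h (x \<otimes>\<^bsub>G\<^esub> y) = u \<otimes>\<^bsub>H\<^esub> v"
      using hom xy by (simp add: hom_mult)
    then have "u \<otimes>\<^bsub>H\<^esub> v \<in> carrier H" "?k (u \<otimes>\<^bsub>H\<^esub> v) = x \<otimes>\<^bsub>G\<^esub> y"
      using bij_betw_apply[OF bij closed[OF xy(1,2)]]
        bij_betw_inv_into_left[OF bij closed[OF xy(1,2)]] by simp_all
    moreover have "h (f (x \<otimes>\<^bsub>G\<^esub> y)) = h (f x) \<otimes>\<^bsub>H\<^esub> h (f y)"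
      using hom fh xy by (simp add: hom_mult hom_in_carrier)
    ultimately show "(\<lambda>y\<in>carrier H. h (f (?k y))) (u \<otimes>\<^bsub>H\<^esub> v)
        = (\<lambda>y\<in>carrier H. h (f (?k y))) u \<otimes>\<^bsub>H\<^esub> (\<lambda>y\<in>carrier H. h (f (?k y))) v"
      using uv by (simp add: x_def y_def)
  qed
  ultimately show ?thesis
    by (simp add: auto_def Bij_def)
qed

lemma auto_extensional: "f \<in> auto G \<Longrightarrow> f \<in> extensional (carrier G)"
  by (simp add: auto_def Bij_def)

lemma auto_closed: "f \<in> auto G \<Longrightarrow> x \<in> carrier G \<Longrightarrow> f x \<in> carrier G"
  by (auto simp: auto_def hom_def)

text \<open>Conjugation by \<open>h\<close> is the isomorphism. Only closure is asked of the
  multiplication of \<open>G\<close>, so the lemma covers both groups and superextensions. The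
  conjugates are restricted to the carrier because members of \<open>auto\<close> are
  extensional.\<close>

lemma AutoGroup_cong:
  assumes h: "h \<in> iso G H"
    and closed: "\<And>x y. x \<in> carrier G \<Longrightarrow> y \<in> carrier G \<Longrightarrow> x \<otimes>\<^bsub>G\<^esub> y \<in> carrier G"
  shows "AutoGroup G \<cong> AutoGroup H"
proof -
  let ?k = "inv_into (carrier G) h"
  let ?c = "\<lambda>f. \<lambda>y\<in>carrier H. h (f (?k y))"
  let ?d = "\<lambda>f. \<lambda>x\<in>carrier G. ?k (f (h x))"
  have bij: "bij_betw h (carrier G) (carrier H)" and hom: "h \<in> hom G H"
    using h by (auto simp: iso_def)
  have k: "bij_betw ?k (carrier H) (carrier G)"
    using bij by (rule bij_betw_inv_into)
  have hk: "h (?k y) = y" "?k y \<in> carrier G" if "y \<in> carrier H" for y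
    using that by (simp_all add: bij_betw_apply[OF k] bij_betw_inv_into_right[OF bij])
  have kh: "?k (h x) = x" "h x \<in> carrier H" if "x \<in> carrier G" for x
    using that by (simp_all add: bij_betw_apply[OF bij] bij_betw_inv_into_left[OF bij])
  have closedH: "u \<otimes>\<^bsub>H\<^esub> v \<in> carrier H \<and> ?k (u \<otimes>\<^bsub>H\<^esub> v) = ?k u \<otimes>\<^bsub>G\<^esub> ?k v"
    if "u \<in> carrier H" "v \<in> carrier H" for u v
    using hom_mult[OF hom hk(2)[OF that(1)] hk(2)[OF that(2)]]
      kh[OF closed[OF hk(2)[OF that(1)] hk(2)[OF that(2)]]] hk that by simp
  have kiso: "?k \<in> iso H G"
    using k closedH bij_betwE[OF k] by (simp add: iso_def hom_def)
  have c: "?c f \<in> auto H" if "f \<in> auto G" for f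
    using h closed that by (rule conj_auto)
  have d: "?d f \<in> auto G" if "f \<in> auto H" for f
  proof -
    have "(\<lambda>x\<in>carrier G. ?k (f (inv_into (carrier H) ?k x))) \<in> auto G"
      using kiso closedH that by (intro conj_auto) auto
    moreover have "inv_into (carrier H) ?k x = h x" if "x \<in> carrier G" for x
      using bij_betw_inv_into_left[OF k kh(2)[OF that]] kh(1)[OF that] by simp
    ultimately show ?thesis
      by (simp cong: restrict_cong)
  qed
  have "bij_betw ?c (auto G) (auto H)"
  proof (rule bij_betw_byWitness[where f' = ?d])
    show "\<forall>f\<in>auto G. ?d (?c f) = f"
    proof
      fix f assume f: "f \<in> auto G"
      show "?d (?c f) = f"
        by (rule extensionalityI[of _ "carrier G"])
          (use f in \<open>auto simp: kh hk auto_closed auto_extensional\<close>)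
    qed
    show "\<forall>f\<in>auto H. ?c (?d f) = f"
    proof
      fix f assume f: "f \<in> auto H"
      show "?c (?d f) = f"
        by (rule extensionalityI[of _ "carrier H"])
          (use f in \<open>auto simp: kh hk auto_closed auto_extensional\<close>)
    qed
    show "?c ` auto G \<subseteq> auto H"
      using c by blast
    show "?d ` auto H \<subseteq> auto G"
      using d by blast
  qed
  moreover have "?c \<in> hom (AutoGroup G) (AutoGroup H)"
  proof (rule homI)
    fix f g assume fg: "f \<in> carrier (AutoGroup G)" "g \<in> carrier (AutoGroup G)"
    then show "?c f \<in> carrier (AutoGroup H)"
      using c by simp
    have fg: "f \<in> auto G" "g \<in> auto G"
      using fg by auto
    have "?c (compose (carrier G) f g) = compose (carrier H) (?c f) (?c g)"
      by (rule extensionalityI[of _ "carrier H"])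
        (use fg in \<open>auto simp: compose_def kh hk auto_closed\<close>)
    then show "?c (f \<otimes>\<^bsub>AutoGroup G\<^esub> g) = ?c f \<otimes>\<^bsub>AutoGroup H\<^esub> ?c g"
      using fg c by (simp add: mult_AutoGroup)
  qed
  ultimately have "?c \<in> iso (AutoGroup G) (AutoGroup H)"
    by (simp add: iso_def)
  then show ?thesis
    by (rule is_isoI)
qed

section \<open>The cyclic group of order five\<close>

text \<open>The residues modulo 5 as a numeral type: finite claims become five-fold case checks
  through \<open>all_5\<close>, and the ring multiplication supplies the group automorphisms as
  scalings.\<close>

definition cyc5 :: "5 monoid" where
  "cyc5 = \<lparr>carrier = UNIV, monoid.mult = (+), one = 0\<rparr>"

lemma cyc5_simps [simp]:
  "carrier cyc5 = UNIV" "monoid.mult cyc5 = (+)" "one cyc5 = 0"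
  by (simp_all add: cyc5_def)

lemma group_cyc5: "group cyc5"
  by (rule groupI) (auto simp: add.assoc intro: exI[of _ "- x" for x :: 5])

lemma UNIV_5: "(UNIV :: 5 set) = {0, 1, 2, 3, 4}"
  by (rule sym, rule card_eq_UNIV_imp_eq_UNIV) simp_all

lemma all_5: "(\<forall>x::5. P x) \<longleftrightarrow> P 0 \<and> P 1 \<and> P 2 \<and> P 3 \<and> P 4"
  using UNIV_5 by (metis UNIV_I insertE singletonD)

abbreviation lam5 :: "5 set set set" where
  "lam5 \<equiv> superextension UNIV"

abbreviation star :: "5 set set \<Rightarrow> 5 set set \<Rightarrow> 5 set set" (infixl \<open>\<star>\<close> 70) where
  "L \<star> M \<equiv> superext_mult cyc5 L M"

lemma star_mem:
  assumes "L \<in> lam5" "M \<in> lam5"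
  shows "X \<in> L \<star> M \<longleftrightarrow> {a. {x. a + x \<in> X} \<in> M} \<in> L"
  using group.superext_mult_eq[OF group_cyc5, of L M] assms by simp

lemma star_lam5: "L \<in> lam5 \<Longrightarrow> M \<in> lam5 \<Longrightarrow> L \<star> M \<in> lam5"
  using group.superext_mult_closed[OF group_cyc5, of L M] by simp

lemma lam5_compl: "L \<in> lam5 \<Longrightarrow> - A \<in> L \<longleftrightarrow> A \<notin> L"
  using superextension_dual[of L UNIV A] by (simp add: Compl_eq_Diff_UNIV)

section \<open>Principal and nonprincipal families\<close>

definition principal :: "'a \<Rightarrow> 'a set set" where
  "principal a = {X. a \<in> X}"

lemma principal_lam5: "principal a \<in> lam5"
  by (rule superextensionI) (auto simp: principal_def)

lemma principal_inject: "principal a = principal b \<longleftrightarrow> a = b"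
proof
  assume "principal a = principal b"
  then have "{b} \<in> principal a"
    by (simp add: principal_def)
  then show "a = b"
    by (simp add: principal_def)
qed simp

lemma principal_star: "L \<in> lam5 \<Longrightarrow> principal a \<star> L = {X. {x. a + x \<in> X} \<in> L}"
  by (rule Set.set_eqI) (simp add: star_mem principal_lam5, simp add: principal_def)

lemma principal_zero_star: "L \<in> lam5 \<Longrightarrow> principal 0 \<star> L = L"
  by (simp add: principal_star)

lemma star_principal_zero: "L \<in> lam5 \<Longrightarrow> L \<star> principal 0 = L"
  by (rule Set.set_eqI) (simp add: star_mem principal_lam5, simp add: principal_def)

lemma principal_star_principal: "principal a \<star> principal b = principal (a + b)"
  by (simp add: principal_star principal_lam5, simp add: principal_def)

definition nonprincipal :: "5 set set set" where
  "nonprincipal = lam5 - range principal"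

lemma nonprincipal_lam5: "L \<in> nonprincipal \<Longrightarrow> L \<in> lam5"
  by (simp add: nonprincipal_def)

text \<open>A member \<open>{a}\<close> forces \<open>L = principal a\<close>: linkedness puts
  \<open>a\<close> into every member, and upward closure makes every set through \<open>a\<close> a
  member.\<close>

lemma nonprincipal_iff:
  assumes L: "L \<in> lam5"
  shows "L \<in> nonprincipal \<longleftrightarrow> (\<forall>a. {a} \<notin> L)"
proof -
  have "L = principal a" if a: "{a} \<in> L" for a
  proof (rule Set.set_eqI)
    fix X
    show "X \<in> L \<longleftrightarrow> X \<in> principal a"
    proof
      assume "X \<in> L"
      then show "X \<in> principal a"
        using superextension_meet[OF L a] by (auto simp: principal_def)
    next
      assume "X \<in> principal a"
      then show "X \<in> L"
        using superextension_upward[OF L a, of X] by (simp add: principal_def)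
    qed
  qed
  moreover have "{a} \<in> principal a" for a :: 5
    by (simp add: principal_def)
  ultimately show ?thesis
    using L unfolding nonprincipal_def by blast
qed

text \<open>The nonprincipal families form an ideal. The product contains \<open>{x}\<close> only if
  the set of \<open>a\<close> with \<open>{x - a}\<close> in \<open>M\<close> belongs to
  \<open>L\<close>; this set is empty for nonprincipal \<open>M\<close> and a singleton for
  principal \<open>M\<close>.\<close>

lemma nonprincipal_star:
  assumes L: "L \<in> lam5" and M: "M \<in> lam5" and np: "L \<in> nonprincipal \<or> M \<in> nonprincipal"
  shows "L \<star> M \<in> nonprincipal"
proof -
  have sing: "{x} \<in> L \<star> M \<longleftrightarrow> {a. {x - a} \<in> M} \<in> L" for x
  proof -
    have "{y. a + y \<in> {x}} = {x - a}" for a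
      by (auto simp: algebra_simps)
    then show ?thesis
      by (simp only: star_mem[OF L M])
  qed
  have "{x} \<notin> L \<star> M" for x
  proof (cases "M \<in> nonprincipal")
    case True
    then show ?thesis
      using M superextension_nonempty[OF L] by (simp add: sing nonprincipal_iff)
  next
    case False
    then obtain b where b: "M = principal b"
      using M by (auto simp: nonprincipal_def)
    have "{a. {x - a} \<in> M} = {x - b}"
      by (auto simp: b principal_def)
    then show ?thesis
      using np False L M by (simp add: sing nonprincipal_iff)
  qed
  then show ?thesis
    using star_lam5[OF L M] by (simp add: nonprincipal_iff)
qed

text \<open>An edge is recorded by its starting point. Two distinct residues differ by 1 or 2 up to
  sign, so the types \<open>d = 1\<close> and \<open>d = 2\<close> label every two-element set
  exactly once.\<close>

definition edges :: "5 set set \<Rightarrow> 5 \<Rightarrow> 5 set" where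
  "edges L d = {x. {x, x + d} \<in> L}"

lemma card_Compl_5: "card X + card (- X) = 5" for X :: "5 set"
proof -
  have "card (X \<union> - X) = card X + card (- X)"
    by (rule card_Un_disjoint) auto
  then show ?thesis
    by (simp add: Compl_partition)
qed

text \<open>A set or its complement has at most two elements, and a two-element set is an edge of
  type 1 or 2.\<close>

lemma set_5_cases:
  fixes X :: "5 set"
  obtains "card X \<le> 1" | x d where "d \<in> {1, 2}" "X = {x, x + d}"
    | x d where "d \<in> {1, 2}" "- X = {x, x + d}" | "card (- X) \<le> 1"
proof -
  have two: "\<exists>x. \<exists>d\<in>{1, 2}. Y = {x, x + d}" if Y: "card Y = 2" for Y :: "5 set"
  proof -
    obtain x y where xy: "Y = {x, y}" "x \<noteq> y"
      using Y by (auto simp: card_2_iff)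
    have "\<forall>x y::5. x \<noteq> y \<longrightarrow> y = x + 1 \<or> y = x + 2 \<or> x = y + 1 \<or> x = y + 2"
      by (simp add: all_5)
    then have "y = x + 1 \<or> y = x + 2 \<or> x = y + 1 \<or> x = y + 2"
      using xy by blast
    then show ?thesis
      using xy by (auto simp: insert_commute)
  qed
  consider "card X \<le> 1" | "card X = 2" | "card (- X) = 2" | "card (- X) \<le> 1"
    using card_Compl_5[of X] by linarith
  then show thesis
  proof cases
    case 2
    then show thesis
      using two[of X] that(2) by auto
  next
    case 3
    then show thesis
      using two[of "- X"] that(3) by auto
  qed (use that in auto)
qed

lemma nonprincipal_small:
  assumes "L \<in> nonprincipal" "card X \<le> 1"
  shows "X \<notin> L"
proof -
  have L: "L \<in> lam5"
    using assms nonprincipal_lam5 by blast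
  have "X = {} \<or> (\<exists>a. X = {a})"
    using assms(2) by (metis card_0_eq card_1_singletonE finite le_neq_implies_less less_one)
  then show ?thesis
    using assms(1) L superextension_nonempty[OF L] nonprincipal_iff[OF L] by auto
qed

text \<open>Sets with at most one element are never members, two-element sets are read off the
  edges, and self-duality decides the larger sets. Equations between nonprincipal families below are
  checked edge by edge with this rule.\<close>

lemma nonprincipal_eqI:
  assumes L: "L \<in> nonprincipal" and M: "M \<in> nonprincipal"
    and edges: "\<And>d. d \<in> {1, 2} \<Longrightarrow> edges L d = edges M d"
  shows "L = M"
proof (rule Set.set_eqI)
  have E: "{x, x + d} \<in> L \<longleftrightarrow> {x, x + d} \<in> M" if "d \<in> {1, 2}" for x d
    using edges[OF that] by (auto simp: edges_def)
  note compl = lam5_compl[OF nonprincipal_lam5[OF L]] lam5_compl[OF nonprincipal_lam5[OF M]]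
  fix X
  show "X \<in> L \<longleftrightarrow> X \<in> M"
  proof (cases X rule: set_5_cases)
    case 1
    then show ?thesis
      using nonprincipal_small[OF L] nonprincipal_small[OF M] by simp
  next
    case (2 x d)
    then show ?thesis
      using E by simp
  next
    case (3 x d)
    then show ?thesis
      using E[of d x] compl[of X] by simp
  next
    case 4
    then show ?thesis
      using nonprincipal_small[OF L, of "- X"] nonprincipal_small[OF M, of "- X"] compl[of X] by simp
  qed
qed

text \<open>Translation preserves the type of an edge, so the edges of type \<open>d\<close> of a
  product see only the edges of the same type of the right factor.\<close>

lemma edges_star:
  assumes "L \<in> lam5" "M \<in> lam5"
  shows "edges (L \<star> M) d = {x. {a. x - a \<in> edges M d} \<in> L}"
proof -
  have "{y. a + y \<in> {x, x + d}} = {x - a, x - a + d}" for a x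
    by (auto simp: algebra_simps)
  then show ?thesis
    using assms by (simp add: edges_def star_mem)
qed

lemma edges_principal_star:
  assumes "L \<in> lam5"
  shows "edges (principal y \<star> L) d = {x. x - y \<in> edges L d}"
  unfolding edges_star[OF principal_lam5 assms] by (simp add: principal_def)

lemma edges_meet:
  assumes "L \<in> lam5" "x \<in> edges L d" "y \<in> edges L e"
  shows "x = y \<or> x = y + e \<or> x + d = y \<or> x + d = y + e"
proof -
  have "{x, x + d} \<inter> {y, y + e} \<noteq> {}"
    using assms superextension_meet unfolding edges_def by blast
  then show ?thesis
    by blast
qed

lemma edges_cases:
  assumes L: "L \<in> lam5" and d: "d \<noteq> 0"
  obtains "edges L d = {}" | y where "edges L d = {y}" | y where "edges L d = {y, y - d}"
proof -
  have near: "x = y \<or> x = y + d \<or> x = y - d" if "x \<in> edges L d" "y \<in> edges L d" for x y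
    using edges_meet[OF L that] by (auto simp: algebra_simps)
  have no3: "\<not> (y \<in> edges L d \<and> y + d \<in> edges L d \<and> y - d \<in> edges L d)" for y
  proof
    assume "y \<in> edges L d \<and> y + d \<in> edges L d \<and> y - d \<in> edges L d"
    then have "y + d = y - d \<or> y + d = y - d + d \<or> y + d = y - d - d"
      using near by blast
    moreover have "\<forall>d y::5. d \<noteq> 0 \<longrightarrow> \<not> (y + d = y - d \<or> y + d = y - d + d \<or> y + d = y - d - d)"
      by (simp add: all_5)
    ultimately show False
      using d by blast
  qed
  show thesis
  proof (cases "edges L d = {}")
    case False
    then obtain y where y: "y \<in> edges L d"
      by blast
    then have sub: "edges L d \<subseteq> {y, y + d, y - d}"
      using near by blast
    consider "y + d \<in> edges L d" | "y - d \<in> edges L d"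
      | "y + d \<notin> edges L d" "y - d \<notin> edges L d"
      by blast
    then show thesis
    proof cases
      case 1
      \<comment> \<open>Written around the common vertex \<open>y + d\<close> to match the third
        case.\<close>
      then have "edges L d = {y + d, y + d - d}"
        using sub y no3[of y] by auto
      then show thesis
        by (rule that(3))
    next
      case 2
      then have "edges L d = {y, y - d}"
        using sub y no3[of y] by auto
      then show thesis
        by (rule that(3))
    next
      case 3
      then have "edges L d = {y}"
        using sub y by blast
      then show thesis
        by (rule that(2))
    qed
  qed (rule that(1))
qed

text \<open>
  A family of pairwise intersecting edges extends to a maximal linked upfamily containing no other
  two-element set: of the three-element sets, it contains those whose complement is not an edge.
\<close>

definition is_edge :: "(5 \<Rightarrow> 5 set) \<Rightarrow> 5 set \<Rightarrow> bool" where
  "is_edge A X \<longleftrightarrow> (\<exists>d\<in>{1, 2}. \<exists>x\<in>A d. X = {x, x + d})"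

definition meeting :: "(5 \<Rightarrow> 5 set) \<Rightarrow> bool" where
  "meeting A \<longleftrightarrow>
    (\<forall>d\<in>{1, 2}. \<forall>e\<in>{1, 2}. \<forall>x\<in>A d. \<forall>y\<in>A e. {x, x + d} \<inter> {y, y + e} \<noteq> {})"

definition family :: "(5 \<Rightarrow> 5 set) \<Rightarrow> 5 set set" where
  "family A = {X. card X \<ge> 4 \<or> (card X = 3 \<and> \<not> is_edge A (- X)) \<or> is_edge A X}"

lemma card_is_edge: "is_edge A X \<Longrightarrow> card X = 2"
  by (auto simp: is_edge_def)

text \<open>Self-duality is built into the definition, which pairs the sizes 2 and 3. Upward closure
  could fail only for an edge inside a three-element set whose complement is an edge, and those two
  edges would be disjoint.\<close>

lemma family_lam5:
  assumes A: "meeting A"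
  shows "family A \<in> lam5"
proof (rule superextensionI)
  have meet: "X \<inter> Y \<noteq> {}" if "is_edge A X" "is_edge A Y" for X Y
    using A that unfolding meeting_def is_edge_def by blast
  show "Y \<in> family A" if X: "X \<in> family A" "X \<subseteq> Y" for X Y
  proof (cases "X = Y")
    case False
    have less: "card X < card Y"
      using X False by (intro psubset_card_mono) auto
    have "X \<inter> - Y = {}"
      using X by blast
    then have "\<not> (is_edge A X \<and> is_edge A (- Y))"
      using meet by blast
    moreover have "card X \<ge> 3 \<or> card X = 2 \<and> is_edge A X"
      using X(1) card_is_edge unfolding family_def by fastforce
    ultimately show ?thesis
      using less unfolding family_def by auto
  qed (use X in simp)
  show "UNIV - X \<in> family A \<longleftrightarrow> X \<notin> family A" for X
  proof -
    have "\<not> (is_edge A X \<and> is_edge A (- X))"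
      using meet[of X "- X"] by blast
    then show ?thesis
      using card_Compl_5[of X] card_is_edge[of A X] card_is_edge[of A "- X"]
      unfolding family_def Compl_eq_Diff_UNIV[symmetric] by auto
  qed
qed simp

lemma family_nonprincipal:
  assumes A: "meeting A"
  shows "family A \<in> nonprincipal"
proof -
  have "{a} \<notin> family A" for a
    using card_is_edge[of A "{a}"] by (auto simp: family_def)
  then show ?thesis
    using family_lam5[OF A] by (simp add: nonprincipal_iff)
qed

lemma edges_family:
  assumes d: "d \<in> {1, 2}"
  shows "edges (family A) d = A d"
proof -
  have "\<forall>x y::5. {x, x + 1} = {y, y + 1} \<longrightarrow> x = y" "\<forall>x y::5. {x, x + 2} = {y, y + 2} \<longrightarrow> x = y"
    "\<forall>x y::5. {x, x + 1} \<noteq> {y, y + 2}" "\<forall>x y::5. {x, x + 2} \<noteq> {y, y + 1}"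
    by (simp_all add: all_5 doubleton_eq_iff)
  then have "is_edge A {x, x + d} \<longleftrightarrow> x \<in> A d" for x
    using d unfolding is_edge_def by auto
  moreover have "card {x, x + d} = 2" for x
    using d by (auto simp: card_insert_if)
  ultimately show ?thesis
    by (auto simp: edges_def family_def)
qed

section \<open>Rigidity\<close>

text \<open>The starts 0 and \<open>- d\<close> belong to the two edges of type \<open>d\<close> at
  the vertex 0. The subsets \<open>D\<close> of \<open>{1, 2}\<close> give all nonprincipal
  idempotents, by \<open>idempotentE\<close>; \<open>idem {}\<close> consists of the sets with at
  least three elements.\<close>

definition idem :: "5 set \<Rightarrow> 5 set set" where
  "idem D = family (\<lambda>d. if d \<in> D then {0, - d} else {})"

definition single :: "5 \<Rightarrow> 5 \<Rightarrow> 5 set set" where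
  "single d b = family (\<lambda>e. if e = d then {b} else {})"

text \<open>These families tie the two edge types together: right multiplication by an idempotent
  recovers either the pair of type \<open>d\<close> or the single edge of the other type.\<close>

definition mixed :: "5 \<Rightarrow> 5 \<Rightarrow> 5 set set" where
  "mixed d b = family (\<lambda>e. if e = d then {0, - d} else {b})"

text \<open>
  The edges \<open>{y, y + e}\<close> of the type \<open>e \<noteq> d\<close> that meet both \<open>{0, d}\<close> and \<open>{- d, 0}\<close>.
\<close>

definition partners :: "5 \<Rightarrow> 5 set" where
  "partners d = (if d = 1 then {0, 3, 4} else {0, 2, 4})"

lemma idem_nonprincipal: "idem D \<in> nonprincipal"
  unfolding idem_def by (rule family_nonprincipal) (auto simp: meeting_def)

lemma edges_idem: "d \<in> {1, 2} \<Longrightarrow> edges (idem D) d = (if d \<in> D then {0, - d} else {})"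
  by (simp add: idem_def edges_family)

lemma single_nonprincipal: "single d b \<in> nonprincipal"
  unfolding single_def by (rule family_nonprincipal) (auto simp: meeting_def)

lemma edges_single: "e \<in> {1, 2} \<Longrightarrow> edges (single d b) e = (if e = d then {b} else {})"
  by (simp add: single_def edges_family)

text \<open>The partners are the two edges of the other type through 0 and the edge joining
  \<open>d\<close> to \<open>- d\<close>; each of them meets both edges of type \<open>d\<close> at
  0.\<close>

lemma mixed_nonprincipal:
  assumes "d \<in> {1, 2}" "b \<in> partners d"
  shows "mixed d b \<in> nonprincipal"
proof -
  have "d = 1 \<and> b \<in> {0, 3, 4} \<or> d = 2 \<and> b \<in> {0, 2, 4}"
    using assms by (auto simp: partners_def)
  then have "meeting (\<lambda>e. if e = d then {0, - d} else {b})"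
    by (elim disjE conjE insertE emptyE; simp add: meeting_def)
  then show ?thesis
    unfolding mixed_def by (rule family_nonprincipal)
qed

lemma edges_mixed: "e \<in> {1, 2} \<Longrightarrow> edges (mixed d b) e = (if e = d then {0, - d} else {b})"
  by (simp add: mixed_def edges_family)

text \<open>The converse of \<open>mixed_nonprincipal\<close>: linkedness alone limits the edges of
  the other type to \<open>partners d\<close>.\<close>

lemma edges_partners:
  assumes L: "L \<in> lam5" and de: "d \<in> {1, 2}" "e \<in> {1, 2}" "d \<noteq> e"
    and "edges L d = {0, - d}" "y \<in> edges L e"
  shows "y \<in> partners d"
proof -
  have "0 = y \<or> 0 = y + e \<or> 0 + d = y \<or> 0 + d = y + e"
    "- d = y \<or> - d = y + e \<or> - d + d = y \<or> - d + d = y + e"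
    using edges_meet[OF L, of 0 d y e] edges_meet[OF L, of "- d" d y e] assms by blast+
  moreover have
    "\<forall>y::5. (0 = y \<or> 0 = y + 2 \<or> 0 + 1 = y \<or> 0 + 1 = y + 2) \<longrightarrow>
      (- 1 = y \<or> - 1 = y + 2 \<or> - 1 + 1 = y \<or> - 1 + 1 = y + 2) \<longrightarrow> y \<in> {0, 3, 4}"
    "\<forall>y::5. (0 = y \<or> 0 = y + 1 \<or> 0 + 2 = y \<or> 0 + 2 = y + 1) \<longrightarrow>
      (- 2 = y \<or> - 2 = y + 1 \<or> - 2 + 2 = y \<or> - 2 + 2 = y + 1) \<longrightarrow> y \<in> {0, 2, 4}"
    by (simp_all add: all_5)
  moreover have "d = 1 \<and> e = 2 \<or> d = 2 \<and> e = 1"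
    using de by auto
  moreover have "partners 1 = {0, 3, 4}" "partners 2 = {0, 2, 4}"
    by (simp_all add: partners_def)
  ultimately show ?thesis
    by metis
qed

text \<open>By \<open>edges_star\<close>, \<open>x\<close> is tested by the set of \<open>a\<close>
  with \<open>x - a\<close> in \<open>{0, - d}\<close>. This set is the edge
  \<open>{x, x + d}\<close> itself, so the type is kept when \<open>d\<close> is in
  \<open>D\<close>; otherwise the test set is empty and the type is discarded.\<close>

lemma edges_star_idem:
  assumes L: "L \<in> lam5" and d: "d \<in> {1, 2}"
  shows "edges (L \<star> idem D) d = (if d \<in> D then edges L d else {})"
proof -
  have "{a. x - a = 0 \<or> x - a = - d} = {x, x + d}" for x
    by (auto simp: algebra_simps)
  moreover have "edges (L \<star> idem D) d = {x. {a. x - a \<in> edges (idem D) d} \<in> L}"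
    by (rule edges_star[OF L nonprincipal_lam5[OF idem_nonprincipal]])
  ultimately show ?thesis
    using superextension_nonempty[OF L] d by (simp add: edges_idem, simp add: edges_def)
qed

lemma star_idem_nonprincipal: "L \<in> lam5 \<Longrightarrow> L \<star> idem D \<in> nonprincipal"
  by (simp add: nonprincipal_star idem_nonprincipal nonprincipal_lam5)

lemma star_idem_full: "L \<in> nonprincipal \<Longrightarrow> L \<star> idem {1, 2} = L"
  by (rule nonprincipal_eqI)
    (auto simp: star_idem_nonprincipal nonprincipal_lam5 edges_star_idem)

lemma star_idem_empty: "L \<in> nonprincipal \<Longrightarrow> L \<star> idem {} = idem {}"
  by (rule nonprincipal_eqI)
    (auto simp: star_idem_nonprincipal nonprincipal_lam5 idem_nonprincipal edges_star_idem edges_idem)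

lemma idem_star_idem: "idem D \<star> idem E = idem (D \<inter> E)"
  by (rule nonprincipal_eqI)
    (auto simp: star_idem_nonprincipal nonprincipal_lam5 idem_nonprincipal edges_star_idem edges_idem)

lemma idem_inject:
  assumes "D \<subseteq> {1, 2}" "E \<subseteq> {1, 2}" "idem D = idem E"
  shows "D = E"
proof -
  have "D = {d \<in> {1, 2}. edges (idem D) d \<noteq> {}}" if "D \<subseteq> {1, 2}" for D
    using that by (auto simp: edges_idem)
  from this[OF assms(1)] this[OF assms(2)] assms(3) show ?thesis
    by simp
qed

text \<open>A single edge of type \<open>d\<close> would make the test set in
  \<open>edges_star\<close> a singleton, which is not a member. For two edges with common vertex
  \<open>y\<close>, idempotence makes the set of starts invariant under translation by
  \<open>y\<close>, and this leaves only \<open>y = 0\<close>.\<close>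

lemma idempotent_edges:
  assumes M: "M \<in> nonprincipal" and idem: "M \<star> M = M" and d: "d \<noteq> 0"
  shows "edges M d = {} \<or> edges M d = {0, - d}"
proof -
  have M5: "M \<in> lam5"
    using M by (rule nonprincipal_lam5)
  have eq: "x \<in> edges M d \<longleftrightarrow> {a. x - a \<in> edges M d} \<in> M" for x
    using edges_star[OF M5 M5, of d] idem by auto
  show ?thesis
  proof (cases rule: edges_cases[OF M5 d])
    case (2 y)
    have "{a. x - a \<in> {y}} = {x - y}" for x
      by (auto simp: algebra_simps)
    then have "y \<notin> edges M d"
      using eq[of y] M nonprincipal_iff[OF M5] by (simp add: 2)
    then show ?thesis
      by (simp add: 2)
  next
    case (3 y)
    have "{a. x - a \<in> edges M d} = {x - y, x - y + d}" for x
      unfolding 3 by (auto simp: algebra_simps)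
    then have "x \<in> edges M d \<longleftrightarrow> {x - y, x - y + d} \<in> M" for x
      using eq[of x] by (simp only:)
    then have shift: "x \<in> edges M d \<longleftrightarrow> x - y \<in> edges M d" for x
      by (simp only: edges_def mem_Collect_eq)
    \<comment> \<open>Since \<open>y\<close> is a start, so is \<open>y - y = 0\<close>; hence
      \<open>y\<close> is 0 or \<open>d\<close>.\<close>
    have "0 \<in> {y, y - d}"
      using shift[of y] by (simp add: 3)
    moreover have "y \<noteq> d"
    proof
      assume "y = d"
      then have "- d \<in> {d, 0}"
        using shift[of 0] by (simp add: 3)
      moreover have "\<forall>d::5. d \<noteq> 0 \<longrightarrow> - d \<notin> {d, 0}"
        by (simp add: all_5)
      ultimately show False
        using d by blast
    qed
    ultimately have "y = 0"
      by auto
    then show ?thesis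
      by (simp add: 3)
  qed simp
qed

lemma idempotentE:
  assumes M: "M \<in> nonprincipal" and "M \<star> M = M"
  obtains D where "D \<subseteq> {1, 2}" "M = idem D"
proof -
  define D where "D = {d \<in> {1, 2}. edges M d \<noteq> {}}"
  have "M = idem D"
  proof (rule nonprincipal_eqI[OF M idem_nonprincipal])
    fix d :: 5 assume d: "d \<in> {1, 2}"
    then have "d \<noteq> 0"
      by auto
    then show "edges M d = edges (idem D) d"
      using idempotent_edges[OF assms] d by (auto simp: edges_idem D_def)
  qed
  then show thesis
    by (rule that[rotated]) (auto simp: D_def)
qed

lemma principal_star_single: "principal c \<star> single d b = single d (b + c)"
proof (rule nonprincipal_eqI)
  show "principal c \<star> single d b \<in> nonprincipal"
    by (simp add: nonprincipal_star principal_lam5 single_nonprincipal nonprincipal_lam5)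
  show "single d (b + c) \<in> nonprincipal"
    by (rule single_nonprincipal)
  show "edges (principal c \<star> single d b) e = edges (single d (b + c)) e" if "e \<in> {1, 2}" for e
    using that
    by (auto simp: edges_principal_star nonprincipal_lam5 single_nonprincipal edges_single algebra_simps)
qed

text \<open>The product has edges of type \<open>d\<close> only. By \<open>edges_cases\<close> there
  are none, one, or two at a common vertex \<open>y\<close>, and in the last case they are the
  translates by \<open>y\<close> of the edges of \<open>idem {d}\<close>.\<close>

lemma star_idem_cases:
  assumes L: "L \<in> lam5" and d: "d \<in> {1, 2}"
  obtains "L \<star> idem {d} = idem {}" | y where "L \<star> idem {d} = single d y"
    | y where "L \<star> idem {d} = principal y \<star> idem {d}"
proof -
  have "d \<noteq> 0"
    using d by auto
  note np = star_idem_nonprincipal[OF L]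
  have y: "principal y \<star> idem {d} \<in> nonprincipal" for y
    by (simp add: nonprincipal_star principal_lam5 idem_nonprincipal nonprincipal_lam5)
  show thesis
  proof (cases rule: edges_cases[OF L \<open>d \<noteq> 0\<close>])
    case 1
    have "L \<star> idem {d} = idem {}"
      by (rule nonprincipal_eqI[OF np idem_nonprincipal])
        (auto simp: edges_star_idem L edges_idem 1)
    then show thesis
      by (rule that(1))
  next
    case (2 y)
    have "L \<star> idem {d} = single d y"
      by (rule nonprincipal_eqI[OF np single_nonprincipal])
        (auto simp: edges_star_idem L edges_single 2)
    then show thesis
      by (rule that(2))
  next
    case (3 z)
    have "L \<star> idem {d} = principal z \<star> idem {d}"
      by (rule nonprincipal_eqI[OF np y])
        (auto simp: edges_star_idem L edges_principal_star nonprincipal_lam5 idem_nonprincipal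
          edges_idem 3 algebra_simps)
    then show thesis
      by (rule that(3))
  qed
qed

section \<open>Automorphisms that fix every principal ultrafilter\<close>

locale principal_fixing =
  fixes \<psi> :: "5 set set \<Rightarrow> 5 set set"
  assumes bij: "bij_betw \<psi> lam5 lam5"
    and mult: "\<And>L M. L \<in> lam5 \<Longrightarrow> M \<in> lam5 \<Longrightarrow> \<psi> (L \<star> M) = \<psi> L \<star> \<psi> M"
    and fix_principal: "\<And>a. \<psi> (principal a) = principal a"
begin

lemma inject: "L \<in> lam5 \<Longrightarrow> M \<in> lam5 \<Longrightarrow> \<psi> L = \<psi> M \<longleftrightarrow> L = M"
  using bij by (meson bij_betw_imp_inj_on inj_on_eq_iff)

lemma closed: "L \<in> lam5 \<Longrightarrow> \<psi> L \<in> lam5"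
  using bij by (rule bij_betw_apply)

lemma nonprincipal:
  assumes L: "L \<in> nonprincipal"
  shows "\<psi> L \<in> nonprincipal"
proof -
  have L5: "L \<in> lam5"
    using L by (rule nonprincipal_lam5)
  have "\<psi> L \<noteq> principal a" for a
    using inject[OF L5 principal_lam5, of a] L by (auto simp: fix_principal nonprincipal_def)
  then show ?thesis
    using closed[OF L5] by (auto simp: nonprincipal_def)
qed

lemma nonprincipal_surj:
  assumes K: "K \<in> nonprincipal"
  obtains L where "L \<in> nonprincipal" "\<psi> L = K"
proof -
  have "K \<in> \<psi> ` lam5"
    using bij K nonprincipal_lam5 by (simp add: bij_betw_def)
  then obtain L where L: "L \<in> lam5" "\<psi> L = K"
    by auto
  then have "L \<notin> range principal"
    using K by (auto simp: fix_principal nonprincipal_def)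
  then show thesis
    using L that by (simp add: nonprincipal_def)
qed

lemma mult_idem: "L \<in> nonprincipal \<Longrightarrow> \<psi> (L \<star> idem D) = \<psi> L \<star> \<psi> (idem D)"
  by (simp add: mult nonprincipal_lam5 idem_nonprincipal)

lemma idem_image:
  obtains E where "E \<subseteq> {1, 2}" "\<psi> (idem D) = idem E"
proof -
  have "\<psi> (idem D) \<star> \<psi> (idem D) = \<psi> (idem D)"
    using mult_idem[OF idem_nonprincipal, of D D] by (simp add: idem_star_idem)
  then show thesis
    using idempotentE[OF nonprincipal[OF idem_nonprincipal]] that by blast
qed

text \<open>By \<open>star_idem_full\<close> this idempotent is a right identity on the nonprincipal
  families. Its image \<open>idem E\<close> is again one, and multiplying \<open>idem {1, 2}\<close>
  by \<open>idem E\<close> gives \<open>idem E\<close>.\<close>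

lemma idem_full: "\<psi> (idem {1, 2}) = idem {1, 2}"
proof -
  obtain E where E: "E \<subseteq> {1, 2}" "\<psi> (idem {1, 2}) = idem E"
    by (rule idem_image)
  obtain L where L: "L \<in> nonprincipal" "\<psi> L = idem {1, 2}"
    by (rule nonprincipal_surj[OF idem_nonprincipal])
  have "idem {1, 2} \<star> idem E = idem {1, 2}"
    using mult_idem[OF L(1), of "{1, 2}"] by (simp add: star_idem_full L E)
  moreover have "{1, 2} \<inter> E = E"
    using E by blast
  ultimately show ?thesis
    using E by (simp add: idem_star_idem)
qed

text \<open>By \<open>star_idem_empty\<close> this idempotent absorbs nonprincipal left factors.
  Applied to the preimage of \<open>idem {}\<close>, this makes the image \<open>idem E\<close>
  equal to \<open>idem {}\<close> times \<open>idem E\<close>, which is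
  \<open>idem {}\<close>.\<close>

lemma idem_empty: "\<psi> (idem {}) = idem {}"
proof -
  obtain E where E: "E \<subseteq> {1, 2}" "\<psi> (idem {}) = idem E"
    by (rule idem_image)
  obtain L where L: "L \<in> nonprincipal" "\<psi> L = idem {}"
    by (rule nonprincipal_surj[OF idem_nonprincipal])
  show ?thesis
    using mult_idem[OF L(1), of "{}"] by (simp add: star_idem_empty L E idem_star_idem)
qed

lemma idem_single:
  assumes d: "d \<in> {1, 2}"
  obtains e where "e \<in> {1, 2}" "\<psi> (idem {d}) = idem {e}"
proof -
  obtain E where E: "E \<subseteq> {1, 2}" "\<psi> (idem {d}) = idem E"
    by (rule idem_image)
  have ne: "\<psi> (idem {d}) \<noteq> \<psi> (idem D)" if "D \<subseteq> {1, 2}" "D \<noteq> {d}" for D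
    using idem_inject[of "{d}" D] that d by (auto simp: inject nonprincipal_lam5 idem_nonprincipal)
  have "E \<noteq> {}"
    using ne[of "{}"] E idem_empty by auto
  moreover have "E \<noteq> {1, 2}"
    using ne[of "{1, 2}"] E idem_full by auto
  ultimately have "E = {1} \<or> E = {2}"
    using E(1) by auto
  then show thesis
    using that E(2) by auto
qed

text \<open>Right multiplication by \<open>idem {e}\<close> fixes the image of
  \<open>single d 0\<close>, so \<open>star_idem_cases\<close> leaves three candidates. Two of them
  are images of \<open>idem {}\<close> and of translates of \<open>idem {d}\<close>, hence excluded
  by injectivity. Left multiplication by the fixed principal ultrafilters then gives the same shift
  \<open>t\<close> for all \<open>b\<close>.\<close>

lemma single_image:
  assumes d: "d \<in> {1, 2}" "e \<in> {1, 2}" and e: "\<psi> (idem {d}) = idem {e}"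
  obtains t where "\<And>b. \<psi> (single d b) = single e (b + t)"
proof -
  let ?K = "single d 0"
  have K: "?K \<in> nonprincipal" and K5: "?K \<in> lam5"
    by (simp_all add: single_nonprincipal nonprincipal_lam5)
  have Kd: "?K \<star> idem {d} = ?K"
    by (rule nonprincipal_eqI)
      (auto simp: star_idem_nonprincipal K K5 edges_star_idem edges_single)
  then have stable: "\<psi> ?K \<star> idem {e} = \<psi> ?K"
    using mult_idem[OF K, of "{d}"] by (simp add: e)
  have ne1: "\<psi> ?K \<noteq> idem {}"
  proof
    assume "\<psi> ?K = idem {}"
    then have "?K = idem {}"
      using inject[of ?K "idem {}"] by (simp add: idem_empty K5 idem_nonprincipal nonprincipal_lam5)
    then have "edges ?K d = edges (idem {}) d"
      by simp
    then show False
      using d by (simp add: edges_single edges_idem)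
  qed
  have ne2: "\<psi> ?K \<noteq> principal y \<star> idem {e}" for y
  proof
    assume "\<psi> ?K = principal y \<star> idem {e}"
    also have "\<dots> = \<psi> (principal y \<star> idem {d})"
      by (simp add: mult principal_lam5 nonprincipal_lam5 idem_nonprincipal fix_principal e)
    finally have "?K = principal y \<star> idem {d}"
      by (simp add: inject K5 star_lam5 principal_lam5 nonprincipal_lam5 idem_nonprincipal)
    then have "edges ?K d = edges (principal y \<star> idem {d}) d"
      by simp
    then have "{0} = {x. x - y = 0 \<or> x - y = - d}"
      using d by (simp add: edges_single edges_principal_star nonprincipal_lam5 idem_nonprincipal edges_idem)
    then have "y \<in> {0}" "y - d \<in> {0}"
      by auto
    then show False
      using d by auto
  qed
  obtain t where t: "\<psi> ?K = single e t"
    by (rule star_idem_cases[OF closed[OF K5] d(2)]) (use ne1 ne2 stable in auto)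
  have "\<psi> (single d b) = single e (b + t)" for b
  proof -
    have "\<psi> (single d b) = \<psi> (principal b \<star> ?K)"
      by (simp add: principal_star_single)
    also have "\<dots> = principal b \<star> single e t"
      by (simp add: mult principal_lam5 K5 fix_principal t)
    finally show ?thesis
      by (simp add: principal_star_single add.commute)
  qed
  then show thesis
    by (rule that)
qed

text \<open>Multiplying the image of \<open>mixed d b\<close> by the images of the two idempotents
  reveals its edges: the pair at 0 of type \<open>d'\<close> and the start \<open>b + t\<close> of
  type \<open>e'\<close>. Linkedness of the image makes \<open>b + t\<close> a partner.\<close>

lemma mixed_image:
  assumes d: "d \<in> {1, 2}" "e \<in> {1, 2}" "d \<noteq> e"
    and d': "d' \<in> {1, 2}" "e' \<in> {1, 2}" "d' \<noteq> e'"
    and \<psi>: "\<psi> (idem {d}) = idem {d'}" "\<psi> (idem {e}) = idem {e'}"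
    and t: "\<And>b. \<psi> (single e b) = single e' (b + t)"
    and b: "b \<in> partners d"
  shows "b + t \<in> partners d'"
proof -
  let ?K = "mixed d b"
  have K: "?K \<in> nonprincipal" and K5: "?K \<in> lam5"
    using mixed_nonprincipal[OF d(1) b] nonprincipal_lam5 by auto
  have "?K \<star> idem {d} = idem {d}"
    by (rule nonprincipal_eqI)
      (use d in \<open>auto simp: star_idem_nonprincipal idem_nonprincipal K5 edges_star_idem edges_mixed edges_idem\<close>)
  then have "\<psi> ?K \<star> idem {d'} = idem {d'}"
    using mult_idem[OF K, of "{d}"] \<psi> by simp
  then have 1: "edges (\<psi> ?K) d' = {0, - d'}"
    using edges_star_idem[OF closed[OF K5] d'(1), of "{d'}"] d' by (simp add: edges_idem)
  have "?K \<star> idem {e} = single e b"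
    by (rule nonprincipal_eqI)
      (use d in \<open>auto simp: star_idem_nonprincipal single_nonprincipal K5 edges_star_idem edges_mixed edges_single\<close>)
  then have "\<psi> ?K \<star> idem {e'} = single e' (b + t)"
    using mult_idem[OF K, of "{e}"] \<psi> t by simp
  then have "edges (\<psi> ?K) e' = {b + t}"
    using edges_star_idem[OF closed[OF K5] d'(2), of "{e'}"] d' by (simp add: edges_single)
  then show ?thesis
    using edges_partners[OF closed[OF K5] d' 1] by simp
qed

text \<open>The constraints are crossed: the shift \<open>t2\<close> of the edges of type 2 moves
  \<open>partners 1\<close> into \<open>partners e1\<close>, and \<open>t1\<close> moves
  \<open>partners 2\<close> into \<open>partners e2\<close>.\<close>

lemma fixes_idem_single:
  assumes d: "d \<in> {1, 2}"
  shows "\<psi> (idem {d}) = idem {d}" "\<psi> (single d b) = single d b"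
proof -
  obtain e1 where e1: "e1 \<in> {1, 2}" "\<psi> (idem {1}) = idem {e1}"
    by (rule idem_single[of 1]) simp_all
  obtain e2 where e2: "e2 \<in> {1, 2}" "\<psi> (idem {2}) = idem {e2}"
    by (rule idem_single[of 2]) simp_all
  have ne: "e1 \<noteq> e2"
  proof
    assume "e1 = e2"
    then have "idem {1} = idem {2}"
      using inject[of "idem {1}" "idem {2}"] e1 e2 by (simp add: nonprincipal_lam5 idem_nonprincipal)
    then show False
      using idem_inject[of "{1}" "{2}"] by simp
  qed
  obtain t1 where t1: "\<And>b. \<psi> (single 1 b) = single e1 (b + t1)"
    by (rule single_image[OF _ e1]) simp_all
  obtain t2 where t2: "\<And>b. \<psi> (single 2 b) = single e2 (b + t2)"
    by (rule single_image[OF _ e2]) simp_all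
  have p1: "b + t2 \<in> partners e1" if "b \<in> partners 1" for b
    by (rule mixed_image[OF _ _ _ e1(1) e2(1) ne e1(2) e2(2) t2 that]) simp_all
  have p2: "b + t1 \<in> partners e2" if "b \<in> partners 2" for b
    by (rule mixed_image[OF _ _ _ e2(1) e1(1) ne[symmetric] e2(2) e1(2) t1 that]) simp_all
  \<comment> \<open>The first two conjuncts force zero shifts once the types are preserved; the
    third excludes swapping the types.\<close>
  have "\<forall>t::5. (0 + t \<in> {0, 3, 4} \<and> 3 + t \<in> {0, 3, 4} \<and> 4 + t \<in> {0, 3, 4} \<longrightarrow> t = 0) \<and>
      (0 + t \<in> {0, 2, 4} \<and> 2 + t \<in> {0, 2, 4} \<and> 4 + t \<in> {0, 2, 4} \<longrightarrow> t = 0) \<and>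
      \<not> (0 + t \<in> {0, 2, 4} \<and> 3 + t \<in> {0, 2, 4} \<and> 4 + t \<in> {0, 2, 4})"
    by (simp add: all_5)
  note key = spec[OF this]
  have partners: "partners 1 = {0, 3, 4}" "partners 2 = {0, 2, 4}"
    by (simp_all add: partners_def)
  have m1: "0 + t2 \<in> partners e1" "3 + t2 \<in> partners e1" "4 + t2 \<in> partners e1"
    by (rule p1; simp add: partners)+
  have m2: "0 + t1 \<in> partners e2" "2 + t1 \<in> partners e2" "4 + t1 \<in> partners e2"
    by (rule p2; simp add: partners)+
  have "e1 \<noteq> 2"
  proof
    assume "e1 = 2"
    show False
      using m1 key[of t2] unfolding \<open>e1 = 2\<close> partners by blast
  qed
  then have "e1 = 1" "e2 = 2"
    using ne e1(1) e2(1) by auto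
  moreover have "t2 = 0"
    using m1 key[of t2] unfolding \<open>e1 = 1\<close> partners by blast
  moreover have "t1 = 0"
    using m2 key[of t1] unfolding \<open>e2 = 2\<close> partners by blast
  ultimately show "\<psi> (idem {d}) = idem {d}" "\<psi> (single d b) = single d b"
    using d e1(2) e2(2) t1 t2 by auto
qed

text \<open>A nonprincipal \<open>L\<close> is determined by its products with
  \<open>idem {1}\<close> and \<open>idem {2}\<close>, and each product is one of the elements of
  \<open>star_idem_cases\<close>, all of which are already known to be fixed.\<close>

lemma fixes_all:
  assumes L: "L \<in> lam5"
  shows "\<psi> L = L"
proof (cases "L \<in> nonprincipal")
  case True
  show ?thesis
  proof (rule nonprincipal_eqI[OF nonprincipal[OF True] True])
    fix d :: 5 assume d: "d \<in> {1, 2}"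
    have "\<psi> (L \<star> idem {d}) = L \<star> idem {d}"
    proof (cases rule: star_idem_cases[OF L d])
      case 1
      then show ?thesis
        by (simp add: idem_empty)
    next
      case (2 y)
      then show ?thesis
        by (simp add: fixes_idem_single[OF d])
    next
      case (3 y)
      then show ?thesis
        by (simp add: mult principal_lam5 nonprincipal_lam5 idem_nonprincipal fix_principal
            fixes_idem_single[OF d])
    qed
    then have "\<psi> L \<star> idem {d} = L \<star> idem {d}"
      using mult_idem[OF True, of "{d}"] by (simp add: fixes_idem_single[OF d])
    then show "edges (\<psi> L) d = edges L d"
      using edges_star_idem[OF closed[OF L] d, of "{d}"] edges_star_idem[OF L d, of "{d}"] by simp
  qed
next
  case False
  then show ?thesis
    using L fix_principal by (auto simp: nonprincipal_def)
qed

end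

section \<open>Automorphism groups\<close>

text \<open>Nonzero residues satisfy \<open>k ^ 4 = 1\<close>, so the inverse is
  \<open>k ^ 3\<close>.\<close>

lemma scale_inverse_5:
  assumes "(k::5) \<noteq> 0"
  obtains j where "j \<noteq> 0" "j * k = 1" "k * j = 1"
proof -
  have "\<forall>k::5. k \<noteq> 0 \<longrightarrow> k ^ 3 \<noteq> 0 \<and> k ^ 3 * k = 1 \<and> k * k ^ 3 = 1"
    by (simp add: all_5)
  then show thesis
    using assms that[of "k ^ 3"] by blast
qed

lemma scale_bij:
  assumes "(k::5) \<noteq> 0"
  shows "bij ((*) k)"
proof -
  obtain j where "j * k = 1" "k * j = 1"
    using assms by (rule scale_inverse_5)
  then show ?thesis
    by (intro o_bij[of "(*) j"]) (auto simp: fun_eq_iff mult.assoc[symmetric])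
qed

lemma scale_iso: "k \<noteq> 0 \<Longrightarrow> (*) k \<in> iso cyc5 cyc5"
  by (simp add: iso_def hom_def scale_bij distrib_left)

lemma additive_5:
  fixes f :: "5 \<Rightarrow> 5"
  assumes add: "\<And>x y. f (x + y) = f x + f y"
  shows "f = (*) (f 1)"
proof
  fix x
  have f0: "f 0 = 0"
    using add[of 0 0] by simp
  have f2: "f 2 = f 1 + f 1"
    using add[of 1 1] by simp
  have f3: "f 3 = f 2 + f 1"
    using add[of 2 1] by simp
  have f4: "f 4 = f 3 + f 1"
    using add[of 3 1] by simp
  have "\<forall>x. f x = f 1 * x"
    unfolding all_5 by (simp add: f0 f2 f3 f4 algebra_simps)
  then show "f x = f 1 * x" ..
qed

lemma auto_cyc5: "auto cyc5 = {(*) k | k. k \<noteq> 0}"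
proof (intro equalityI subsetI)
  fix f assume f: "f \<in> auto cyc5"
  then have eq: "f = (*) (f 1)"
    by (intro additive_5) (auto simp: auto_def hom_def)
  have "inj f"
    using f by (auto simp: auto_def Bij_def bij_betw_def)
  then have "f 1 \<noteq> f 0"
    by (simp add: inj_eq)
  moreover have "f 0 = 0"
    by (subst eq) simp
  ultimately show "f \<in> {(*) k | k. k \<noteq> 0}"
    using eq by auto
next
  fix f :: "5 \<Rightarrow> 5" assume "f \<in> {(*) k | k. k \<noteq> 0}"
  then show "f \<in> auto cyc5"
    using scale_iso by (auto simp: auto_def Bij_def iso_def)
qed

lemma scale_inject: "(*) j = (*) k \<longleftrightarrow> j = k" for j k :: 5
  by (metis mult.right_neutral)

lemma AutoGroup_cyc5: "AutoGroup cyc5 \<cong> integer_mod_group 4"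
proof -
  \<comment> \<open>2 is a primitive root modulo 5: its powers run through all nonzero
    scalings.\<close>
  let ?h = "\<lambda>n. (*) ((2::5) ^ nat n)"
  have C: "carrier (integer_mod_group 4) = {0, 1, 2, 3}"
    by (auto simp: carrier_integer_mod_group)
  have ne: "(2::5) ^ n \<noteq> 0" for n
  proof (induction n)
    case (Suc n)
    have "\<forall>x::5. x \<noteq> 0 \<longrightarrow> 2 * x \<noteq> 0"
      by (simp add: all_5)
    then show ?case
      using Suc by simp
  qed simp
  have "bij_betw ?h {0, 1, 2, 3} (auto cyc5)"
  proof (rule bij_betw_imageI)
    show "inj_on ?h {0, 1, 2, 3}"
      by (auto simp: inj_on_def scale_inject)
    have "\<forall>k::5. k \<noteq> 0 \<longrightarrow> k = 2 ^ 0 \<or> k = 2 ^ 1 \<or> k = 2 ^ 2 \<or> k = 2 ^ 3"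
      by (simp add: all_5)
    moreover have "?h ` {0, 1, 2, 3} = {(*) (2 ^ 0), (*) (2 ^ 1), (*) (2 ^ 2), (*) (2 ^ 3)}"
      by simp
    ultimately show "?h ` {0, 1, 2, 3} = auto cyc5"
      using ne unfolding auto_cyc5 by blast
  qed
  moreover have "?h \<in> hom (integer_mod_group 4) (AutoGroup cyc5)"
  proof (rule homI)
    fix m n assume mn: "m \<in> carrier (integer_mod_group 4)" "n \<in> carrier (integer_mod_group 4)"
    have h: "?h n \<in> auto cyc5" for n
      using ne by (auto simp: auto_cyc5)
    show "?h m \<in> carrier (AutoGroup cyc5)"
      using h by simp
    have "(2::5) ^ nat ((m + n) mod 4) = 2 ^ nat m * 2 ^ nat n"
      using mn unfolding C by auto
    then show "?h (m \<otimes>\<^bsub>integer_mod_group 4\<^esub> n) = ?h m \<otimes>\<^bsub>AutoGroup cyc5\<^esub> ?h n"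
      using h by (simp add: mult_AutoGroup fun_eq_iff compose_def mult.assoc)
  qed
  ultimately have "?h \<in> iso (integer_mod_group 4) (AutoGroup cyc5)"
    by (simp add: iso_def C)
  then show ?thesis
    using group.iso_sym[OF group_integer_mod_group] is_isoI by blast
qed

section \<open>Scalings acting on the superextension\<close>

lemma image_scale_principal:
  assumes "(k::5) \<noteq> 0"
  shows "image ((*) k) ` principal a = principal (k * a)"
proof (rule Set.set_eqI)
  fix X
  have "X \<in> image ((*) k) ` principal a \<longleftrightarrow> {x \<in> UNIV. k * x \<in> X} \<in> principal a"
    by (rule image_image_mem_iff[OF scale_bij[OF assms]]) auto
  then show "X \<in> image ((*) k) ` principal a \<longleftrightarrow> X \<in> principal (k * a)"
    by (simp add: principal_def)
qed

lemma image_scale_scale: "image ((*) j) ` image ((*) k) ` L = image ((*) (j * k)) ` L" for j k :: 5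
  by (simp add: image_image mult.assoc)

lemma image_scale_star:
  assumes "k \<noteq> 0" "L \<in> lam5" "M \<in> lam5"
  shows "image ((*) k) ` (L \<star> M) = image ((*) k) ` L \<star> image ((*) k) ` M"
  using superext_mult_image[OF group_cyc5 group_cyc5 scale_iso, of k L M] assms by simp

text \<open>The action on principal ultrafilters is an additive map of residues, hence a scaling by
  some \<open>f 1\<close>. Undoing this scaling leaves an automorphism to which
  \<open>fixes_all\<close> applies.\<close>

lemma auto_superext_cyc5E:
  assumes \<psi>: "\<psi> \<in> auto (superext_semigroup cyc5)"
  obtains k where "k \<noteq> 0" "\<forall>L\<in>lam5. \<psi> L = image ((*) k) ` L"
proof -
  have bij: "bij_betw \<psi> lam5 lam5"
    and mult: "\<And>L M. L \<in> lam5 \<Longrightarrow> M \<in> lam5 \<Longrightarrow> \<psi> (L \<star> M) = \<psi> L \<star> \<psi> M"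
    using \<psi> by (auto simp: auto_def Bij_def hom_def)
  have closed: "\<psi> L \<in> lam5" if "L \<in> lam5" for L
    using bij that by (rule bij_betw_apply)
  have unit: "\<psi> (principal 0) = principal 0"
  proof -
    \<comment> \<open>The right identity law for the preimage of \<open>principal 0\<close> is
      mapped to an equation whose right factor must be \<open>principal 0\<close>.\<close>
    have "principal 0 \<in> \<psi> ` lam5"
      using bij principal_lam5 by (simp add: bij_betw_def)
    then obtain L where L: "L \<in> lam5" "\<psi> L = principal 0"
      by auto
    then have "principal 0 = principal 0 \<star> \<psi> (principal 0)"
      using mult[OF L(1) principal_lam5, of 0] by (simp add: star_principal_zero)
    then show ?thesis
      by (simp add: principal_zero_star closed principal_lam5)
  qed
  \<comment> \<open>\<open>principal a\<close> has the inverse \<open>principal (- a)\<close>,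
    whereas products with a nonprincipal factor never reach \<open>principal 0\<close>.\<close>
  have "\<exists>b. \<psi> (principal a) = principal b" for a
  proof (rule ccontr)
    assume "\<nexists>b. \<psi> (principal a) = principal b"
    then have "\<psi> (principal a) \<in> nonprincipal"
      using closed principal_lam5 by (auto simp: nonprincipal_def)
    then have "\<psi> (principal a) \<star> \<psi> (principal (- a)) \<in> nonprincipal"
      by (simp add: nonprincipal_star closed principal_lam5)
    then have "principal 0 \<in> nonprincipal"
      using mult[OF principal_lam5 principal_lam5, of a "- a"] unit
      by (simp add: principal_star_principal)
    then show False
      by (simp add: nonprincipal_def)
  qed
  then obtain f where f: "\<And>a. \<psi> (principal a) = principal (f a)"
    by metis
  have "f (a + b) = f a + f b" for a b
    using mult[OF principal_lam5 principal_lam5, of a b]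
    by (simp add: principal_star_principal f principal_inject)
  then have scale: "f = (*) (f 1)"
    by (rule additive_5)
  have "\<psi> (principal 1) \<noteq> \<psi> (principal 0)"
    using bij principal_lam5 principal_inject[of "1::5" 0]
    by (metis bij_betw_imp_inj_on inj_on_eq_iff zero_neq_one)
  then have "f 1 \<noteq> 0"
    using unit f by auto
  then obtain j where j: "j \<noteq> 0" "j * f 1 = 1" "f 1 * j = 1"
    by (rule scale_inverse_5)
  interpret principal_fixing "\<lambda>L. image ((*) j) ` \<psi> L"
  proof
    have "bij_betw (\<lambda>L. image ((*) j) ` L) lam5 lam5"
      using bij_betw_superextension_image[OF scale_bij[OF j(1)]] by simp
    from bij_betw_trans[OF bij this] show "bij_betw (\<lambda>L. image ((*) j) ` \<psi> L) lam5 lam5"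
      by (simp add: comp_def)
    show "image ((*) j) ` \<psi> (L \<star> M) = image ((*) j) ` \<psi> L \<star> image ((*) j) ` \<psi> M"
      if "L \<in> lam5" "M \<in> lam5" for L M
      using that by (simp add: mult image_scale_star j closed)
    show "image ((*) j) ` \<psi> (principal a) = principal a" for a
    proof -
      have "image ((*) j) ` \<psi> (principal a) = principal (j * f a)"
        by (simp add: f image_scale_principal j)
      also have "j * f a = a"
        using j(2) by (subst scale) (simp add: mult.assoc[symmetric])
      finally show ?thesis .
    qed
  qed
  have "\<psi> L = image ((*) (f 1)) ` L" if "L \<in> lam5" for L
  proof -
    have "image ((*) (f 1)) ` L = image ((*) (f 1)) ` image ((*) j) ` \<psi> L"
      using fixes_all[OF that] by simp
    also have "\<dots> = \<psi> L"
      by (simp only: image_scale_scale j) simp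
    finally show ?thesis
      by simp
  qed
  then show thesis
    using \<open>f 1 \<noteq> 0\<close> by (intro that ballI)
qed

text \<open>The isomorphism is pushforward of families. The image of \<open>principal 1\<close>
  recovers the scaling factor, which gives injectivity; surjectivity is
  \<open>auto_superext_cyc5E\<close>.\<close>

lemma AutoGroup_superext_cyc5: "AutoGroup cyc5 \<cong> AutoGroup (superext_semigroup cyc5)"
proof -
  let ?\<Phi> = "\<lambda>f. \<lambda>L\<in>lam5. image f ` L"
  have \<Phi>: "?\<Phi> f \<in> auto (superext_semigroup cyc5)" if "f \<in> auto cyc5" for f
  proof -
    have "f \<in> iso cyc5 cyc5"
      using that by (auto simp: auto_def Bij_def iso_def)
    then have "(\<lambda>L. image f ` L) \<in> iso (superext_semigroup cyc5) (superext_semigroup cyc5)"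
      by (rule superext_semigroup_iso[OF group_cyc5 group_cyc5])
    moreover from this have "bij_betw (?\<Phi> f) lam5 lam5"
      by (subst bij_betw_cong[where g = "\<lambda>L. image f ` L"]) (simp_all add: iso_def)
    ultimately show ?thesis
      by (simp add: auto_def Bij_def iso_def hom_def star_lam5 Pi_iff)
  qed
  have "bij_betw ?\<Phi> (auto cyc5) (auto (superext_semigroup cyc5))"
  proof (rule bij_betw_imageI)
    show "inj_on ?\<Phi> (auto cyc5)"
    proof (rule inj_onI)
      fix f g assume fg: "f \<in> auto cyc5" "g \<in> auto cyc5" and eq: "?\<Phi> f = ?\<Phi> g"
      obtain j k where jk: "j \<noteq> 0" "k \<noteq> 0" "f = (*) j" "g = (*) k"
        using fg by (auto simp: auto_cyc5)
      have "?\<Phi> f (principal 1) = ?\<Phi> g (principal 1)"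
        by (simp only: eq)
      then show "f = g"
        using jk by (simp add: principal_lam5 image_scale_principal principal_inject)
    qed
    have "\<psi> \<in> ?\<Phi> ` auto cyc5" if \<psi>: "\<psi> \<in> auto (superext_semigroup cyc5)" for \<psi>
    proof -
      obtain k where k: "k \<noteq> 0" "\<forall>L\<in>lam5. \<psi> L = image ((*) k) ` L"
        using \<psi> by (rule auto_superext_cyc5E)
      have "\<psi> = ?\<Phi> ((*) k)"
        by (rule extensionalityI[of _ lam5]) (use auto_extensional[OF \<psi>] k(2) in auto)
      then show ?thesis
        using k(1) by (auto simp: auto_cyc5)
    qed
    then show "?\<Phi> ` auto cyc5 = auto (superext_semigroup cyc5)"
      using \<Phi> by blast
  qed
  moreover have "?\<Phi> \<in> hom (AutoGroup cyc5) (AutoGroup (superext_semigroup cyc5))"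
  proof (rule homI)
    fix f g assume "f \<in> carrier (AutoGroup cyc5)" "g \<in> carrier (AutoGroup cyc5)"
    then have fg: "f \<in> auto cyc5" "g \<in> auto cyc5"
      by simp_all
    then show "?\<Phi> f \<in> carrier (AutoGroup (superext_semigroup cyc5))"
      using \<Phi> by simp
    have "image g ` L \<in> lam5" if "L \<in> lam5" for L
      using auto_closed[OF \<Phi>[OF fg(2)], of L] that by simp
    then show "?\<Phi> (f \<otimes>\<^bsub>AutoGroup cyc5\<^esub> g) = ?\<Phi> f \<otimes>\<^bsub>AutoGroup (superext_semigroup cyc5)\<^esub> ?\<Phi> g"
      using fg \<Phi> by (auto simp: mult_AutoGroup compose_def image_image fun_eq_iff)
  qed
  ultimately have "?\<Phi> \<in> iso (AutoGroup cyc5) (AutoGroup (superext_semigroup cyc5))"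
    by (simp add: iso_def)
  then show ?thesis
    by (rule is_isoI)
qed

section \<open>Identification of an arbitrary cyclic group of order 5\<close>

lemma of_int_5_eq_0:
  assumes "of_int k = (0::5)"
  shows "5 dvd k"
proof -
  have "of_int k = (of_int (5 * (k div 5) + k mod 5) :: 5)"
    by simp
  also have "\<dots> = of_int 5 * of_int (k div 5) + of_int (k mod 5)"
    by (simp only: of_int_add of_int_mult)
  also have "of_int 5 = (0::5)"
    by simp
  finally have "of_int (k mod 5) = (0::5)"
    using assms by simp
  moreover have "k mod 5 \<in> {0, 1, 2, 3, 4}"
    by auto
  ultimately have "k mod 5 = 0"
    by auto
  then show ?thesis
    by auto
qed

text \<open>Powers of a generator depend only on the exponent modulo 5, so any choice
  \<open>r\<close> of integer representatives gives a homomorphism. It is onto because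
  \<open>g\<close> generates, and injective by counting.\<close>

lemma cyclic_order_5_iso:
  fixes G (structure)
  assumes "group G" and "cyclic_group G" and "order G = 5"
  shows "G \<cong> cyc5"
proof -
  interpret group G by (rule assms(1))
  obtain g where g: "g \<in> carrier G" "carrier G = range (\<lambda>n::int. g [^] n)"
    using assms(2) unfolding cyclic_group by blast
  have g5: "g [^] (5::int) = \<one>"
    using pow_order_eq_1[OF g(1)] assms(3) int_pow_int[of G g 5] by simp
  have eq: "g [^] m = g [^] n" if mn: "of_int m = (of_int n :: 5)" for m n :: int
  proof -
    obtain q where "m - n = 5 * q"
      using of_int_5_eq_0[of "m - n"] mn by auto
    then have "m = n + 5 * q"
      by simp
    then have "g [^] m = g [^] n \<otimes> (g [^] (5::int)) [^] q"
      using g(1) by (simp only: int_pow_mult int_pow_pow)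
    then show ?thesis
      using g(1) by (simp add: g5)
  qed
  define r :: "5 \<Rightarrow> int" where "r x = (SOME n. of_int n = x)" for x
  have "\<forall>x::5. \<exists>n. of_int n = x"
    unfolding all_5 by (metis of_int_0 of_int_1 of_int_numeral)
  then have r: "of_int (r x) = x" for x
    unfolding r_def by (metis (mono_tags) someI_ex)
  let ?h = "\<lambda>x. g [^] r x"
  have h: "?h (of_int n) = g [^] n" for n
    by (rule eq) (rule r)
  have surj: "range ?h = carrier G"
  proof
    show "range ?h \<subseteq> carrier G"
      using g(1) by auto
    show "carrier G \<subseteq> range ?h"
      unfolding g(2) using h by (auto intro: range_eqI[OF sym])
  qed
  then have "inj ?h"
    using assms(3) by (intro eq_card_imp_inj_on) (simp_all add: order_def)
  then have "bij_betw ?h UNIV (carrier G)"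
    using surj by (simp add: bij_betw_def)
  moreover have "?h (x + y) = ?h x \<otimes> ?h y" for x y
    using h[of "r x + r y"] g(1) by (simp add: r int_pow_mult)
  ultimately have "?h \<in> iso cyc5 G"
    using g(1) by (simp add: iso_def hom_def)
  then show ?thesis
    using group.iso_sym[OF group_cyc5] is_isoI by blast
qed

theorem theorem2p2:
  fixes C5 :: "'a monoid"
  assumes "group C5" and "cyclic_group C5" and "order C5 = 5"
  shows "AutoGroup (superext_semigroup C5) \<cong> AutoGroup C5 \<and>
         AutoGroup C5 \<cong> integer_mod_group 4"
proof -
  \<comment> \<open>Both automorphism groups are carried to \<open>cyc5\<close> along
    \<open>h\<close> and along its pushforward.\<close>
  obtain h where h: "h \<in> iso C5 cyc5"
    using cyclic_order_5_iso[OF assms] by (auto simp: is_iso_def)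
  have 1: "AutoGroup C5 \<cong> AutoGroup cyc5"
    using h by (rule AutoGroup_cong) (simp add: group.is_monoid assms(1) monoid.m_closed)
  have "AutoGroup (superext_semigroup C5) \<cong> AutoGroup (superext_semigroup cyc5)"
    using superext_semigroup_iso[OF assms(1) group_cyc5 h]
    by (rule AutoGroup_cong) (simp add: group.superext_mult_closed[OF assms(1)])
  also have "\<dots> \<cong> AutoGroup cyc5"
    using AutoGroup_superext_cyc5 by (rule group.iso_sym[OF group.AutoGroup[OF group_cyc5]])
  also have "\<dots> \<cong> AutoGroup C5"
    using 1 by (rule group.iso_sym[OF group.AutoGroup[OF assms(1)]])
  finally show ?thesis
    using iso_trans[OF 1 AutoGroup_cyc5] by simp
qed

end
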